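(* Let $l\in\mathbb{N}$, $\mathbf{p}=(p_1,\dots,p_l)\in\mathbb{N}^l$, $p=p_1+\cdots+p_l$, $\mathbf{h}\in\mathbb{C}^l$ and $a,b,d,e\in\mathbb{C}$ be such that both series below terminate. Then $$ F\left(\begin{matrix} a,\;1-a,\;d,\;\mathbf{h}+\mathbf{p} \\ b,\;e,\;\mathbf{h} \end{matrix}\right) =\frac{\Gamma(e+b-d-1)\,\Gamma(e)}{\Gamma(e+b-1)\,(2-e-b+d)_{p}\,(\mathbf{h})_{\mathbf{p}}}\, F\left(\begin{matrix} (b-a)/2,\;(a+b-1)/2,\;d,\;e+b-d-p-1 \\ b,\;\Delta(e+b-1,2) \end{matrix}\;\vdots\;Y_p(1,-1)\right), $$ where $Y_p(1,-1)$ denotes the polynomial $t\mapsto Y_p(1,-1;t)$ (defined in the context) with $\lambda=b-1$.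
   Context: Notation: $(a)_n=\Gamma(a+n)/\Gamma(a)$; for vectors, $(\mathbf{a})_n=\prod_j(a_j)_n$, $(\mathbf{h})_{\mathbf{p}}=\prod_i(h_i)_{p_i}$, and $\mathbf{a}+\beta$ means adding $\beta$ to each component. $\Delta(a,2)=(a/2,(a+1)/2)$. For a polynomial $P$, $$F\left(\begin{matrix} \mathbf{a} \\ \mathbf{b} \end{matrix}\;\vdots\;P\right)=\sum_{n\ge0}\frac{(\mathbf{a})_n}{(\mathbf{b})_n\,n!}P(n),$$ with $P\equiv1$ when omitted (unit argument). A series terminates if one of its upper parameters is a non-positive integer. Standing convention: lower parameters are never non-positive integers, and all Gamma functions are defined and all denominators non-zero. $$ Y_p(u,v;t)=\frac{(\mathbf{h}-d)_{\mathbf{p}}}{\Gamma(e-d)}\sum_{j=0}^{p}\frac{(d-e+1)_{j}}{j!}\,F\left(\begin{matrix} -j,1-\mathbf{h}+d \\ 1-\mathbf{h}+d-\mathbf{p} \end{matrix}\right)(ut+d)_{j}\,(vt+d-e-\lambda+j+1)_{p-j}. $$ *)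

theory Defs
  imports "HOL-Analysis.Analysis"
begin

text \<open>
  Vectors of parameters are lists. The symbol $(a)_n$ is the rising factorial
  \<^const>\<open>pochhammer\<close>, which agrees with $\Gamma(a+n)/\Gamma(a)$ wherever that quotient is
  defined and extends it to the non-positive integers (the terminating case).
\<close>

definition vpoch :: "complex list \<Rightarrow> nat \<Rightarrow> complex" where
  "vpoch as n = (\<Prod>a\<leftarrow>as. pochhammer a n)"

definition vpoch_vec :: "complex list \<Rightarrow> nat list \<Rightarrow> complex" where
  "vpoch_vec hs ps = (\<Prod>(h, p)\<leftarrow>zip hs ps. pochhammer h p)"

definition Delta2 :: "complex \<Rightarrow> complex list" where
  "Delta2 a = [a / 2, (a + 1) / 2]"

definition hyp_P :: "complex list \<Rightarrow> complex list \<Rightarrow> (complex \<Rightarrow> complex) \<Rightarrow> complex" where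
  "hyp_P as bs P = (\<Sum>n. vpoch as n / (vpoch bs n * fact n) * P (of_nat n))"

definition hyp :: "complex list \<Rightarrow> complex list \<Rightarrow> complex" where
  "hyp as bs = hyp_P as bs (\<lambda>t. 1)"

definition terminating :: "complex list \<Rightarrow> bool" where
  "terminating as \<longleftrightarrow> (\<exists>a\<in>set as. a \<in> \<int>\<^sub>\<le>\<^sub>0)"

definition admissible_lower :: "complex list \<Rightarrow> bool" where
  "admissible_lower bs \<longleftrightarrow> (\<forall>b\<in>set bs. b \<notin> \<int>\<^sub>\<le>\<^sub>0)"

definition Y_upper :: "complex list \<Rightarrow> complex \<Rightarrow> complex list" where
  "Y_upper hs d = map (\<lambda>h. 1 - h + d) hs"

definition Y_lower :: "complex list \<Rightarrow> nat list \<Rightarrow> complex \<Rightarrow> complex list" where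
  "Y_lower hs ps d = map2 (\<lambda>h p. 1 - h + d - of_nat p) hs ps"

definition Y_poly ::
  "complex list \<Rightarrow> nat list \<Rightarrow> complex \<Rightarrow> complex \<Rightarrow> complex \<Rightarrow> complex \<Rightarrow> complex \<Rightarrow> complex \<Rightarrow> complex"
where
  "Y_poly hs ps d e lam u v t =
     vpoch_vec (map (\<lambda>h. h - d) hs) ps / Gamma (e - d) *
     (\<Sum>j = 0..sum_list ps.
        pochhammer (d - e + 1) j / fact j *
        hyp (- of_nat j # Y_upper hs d) (Y_lower hs ps d) *
        pochhammer (u * t + d) j *
        pochhammer (v * t + d - e - lam + of_nat j + 1) (sum_list ps - j))"

end

(* By Newton interpolation the polynomial prod_i (h_i + x)_{p_i} is a combination of the basis
   (x + d)_j, j <= p; up to the factor (h - d)_p, the inner terminating series of Y_p is j! times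
   the j-th coefficient. Since (d)_k (d + k)_j = (d)_j (d + j)_k, comparing coefficients reduces
   the theorem to l = 0 with d replaced by d + j. That case is the quadratic transformation
   2F1(a, 1-a; b; x) = (1-x)^(b-1) 2F1((b-a)/2, (a+b-1)/2; b; 4x(1-x)), read off coefficientwise and
   integrated against a beta weight, which amounts to the Chu-Vandermonde sum. Besides d = -n, the
   hypotheses only allow a = -n (or 1 - a = -n) together with b = n + 1 - 2m >= 1; then
   Chu-Vandermonde terminates through 1 - b - t instead of d + t. *)
theory Submission
  imports Defs
begin

section \<open>The quadratic transformation of 2F1(a, 1-a; b), coefficient by coefficient\<close>

text \<open>The coefficient of (x(1-x))^t in 2F1((b-a)/2, (a+b-1)/2; b; 4x(1-x)), with the 4^t of
  the argument absorbed.\<close>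

definition quad_coeff :: "complex \<Rightarrow> complex \<Rightarrow> nat \<Rightarrow> complex" where
  "quad_coeff a b t =
     4 ^ t * pochhammer ((b - a) / 2) t * pochhammer ((a + b - 1) / 2) t / (pochhammer b t * fact t)"

lemma quad_coeff_Suc:
  assumes "b \<notin> \<int>\<^sub>\<le>\<^sub>0"
  shows "(b + of_nat t) * of_nat (Suc t) * quad_coeff a b (Suc t) =
    (b - a + 2 * of_nat t) * (a + b - 1 + 2 * of_nat t) * quad_coeff a b t"
proof -
  have "pochhammer b (Suc t) \<noteq> 0"
    using assms pochhammer_eq_0_imp_nonpos_Int by blast
  hence bt: "b + of_nat t \<noteq> 0"
    by (auto simp: pochhammer_Suc)
  have cancel: "x * n * (4 * u * (A * y) * (B * z) / ((P * x) * (n * f))) = 2 * y * (2 * z) * (u * A * B / (P * f))"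
    if "x \<noteq> 0" "n \<noteq> 0" for x n u A y B z P f :: complex
    using that by (simp add: divide_simps)
  have "(b + of_nat t) * of_nat (Suc t) * quad_coeff a b (Suc t) =
    2 * ((b - a) / 2 + of_nat t) * (2 * ((a + b - 1) / 2 + of_nat t)) * quad_coeff a b t"
    unfolding quad_coeff_def pochhammer_Suc fact_Suc power_Suc
    by (rule cancel) (use bt in \<open>auto simp del: of_nat_Suc\<close>)
  also have "2 * ((b - a) / 2 + of_nat t) = b - a + 2 * of_nat t"
    by (simp add: field_simps)
  also have "2 * ((a + b - 1) / 2 + of_nat t) = a + b - 1 + 2 * of_nat t"
    by (simp add: field_simps)
  finally show ?thesis .
qed

text \<open>The coefficient of \<open>x\<^sup>k\<close> in \<open>x\<^sup>t (1 - x)\<^bsup>b - 1 + t\<^esup>\<close>.\<close>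

definition bin_coeff :: "complex \<Rightarrow> nat \<Rightarrow> nat \<Rightarrow> complex" where
  "bin_coeff b k t = pochhammer (1 - b - of_nat t) (k - t) / fact (k - t)"

text \<open>Let L y = x(1-x) y'' + (b-2x) y' be the operator in the hypergeometric equation of
  2F1(a, 1-a; b), and f_t = x^t (1-x)^(b-1+t). Then L f_t = t(b+t-1) f_{t-1} - (b+2t)(b+2t-1) f_t.
  The recurrence compares the coefficients of x^k, since L turns c_k into (b+k)(k+1) c_{k+1} -
  k(k+1) c_k.\<close>

lemma bin_coeff_rec:
  assumes "t \<le> k"
  shows "(b + of_nat k) * of_nat (Suc k) * bin_coeff b (Suc k) t =
    of_nat t * (b + of_nat t - 1) * bin_coeff b k (t - 1) +
    (of_nat k * of_nat (Suc k) - (b + 2 * of_nat t) * (b + 2 * of_nat t - 1)) * bin_coeff b k t"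
proof -
  obtain m where k: "k = t + m"
    using assms le_Suc_ex by blast
  define x where "x = 1 - b - of_nat t"
  define P where "P = pochhammer x m"
  have 1: "bin_coeff b (Suc k) t = P * (x + of_nat m) / (of_nat (Suc m) * fact m)"
    by (simp add: bin_coeff_def k x_def P_def Suc_diff_le pochhammer_Suc)
  have 2: "bin_coeff b k t = P / fact m"
    by (simp add: bin_coeff_def k x_def P_def)
  \<comment> \<open>Lowering t by one turns x into x + 1 and m into m + 1, and b + t - 1 = -x
    supplies the missing first factor. At t = 0 the truncated \<open>t - 1\<close> is harmless
    because of the factor t.\<close>
  have 3: "of_nat t * (b + of_nat t - 1) * bin_coeff b k (t - 1) =
      - of_nat t * (P * (x + of_nat m) * (x + of_nat m + 1)) / (of_nat (Suc m) * fact m)"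
  proof (cases t)
    case 0
    then show ?thesis by simp
  next
    case (Suc t')
    have "bin_coeff b k (t - 1) = pochhammer (x + 1) (Suc m) / (of_nat (Suc m) * fact m)"
      by (simp add: bin_coeff_def k x_def Suc algebra_simps del: of_nat_Suc)
         (simp add: algebra_simps)
    moreover have "x * pochhammer (x + 1) (Suc m) = P * (x + of_nat m) * (x + of_nat m + 1)"
      by (simp add: pochhammer_rec [symmetric] P_def) (simp add: pochhammer_Suc algebra_simps)
    moreover have "b + of_nat t - 1 = - x"
      by (simp add: x_def)
    ultimately show ?thesis
      by (metis (no_types, lifting) mult.assoc minus_mult_left minus_mult_right times_divide_eq_right)
  qed
  \<comment> \<open>All three values are multiples of P / ((m+1) m!), so a polynomial identity
    remains.\<close>
  have key: "(b + of_nat k) * of_nat (Suc k) * (x + of_nat m) =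
      - of_nat t * ((x + of_nat m) * (x + of_nat m + 1)) +
     (of_nat k * of_nat (Suc k) - (b + 2 * of_nat t) * (b + 2 * of_nat t - 1)) * of_nat (Suc m)"
    by (simp add: x_def k algebra_simps)
  have "(b + of_nat k) * of_nat (Suc k) * bin_coeff b (Suc k) t =
    P * ((b + of_nat k) * of_nat (Suc k) * (x + of_nat m)) / (of_nat (Suc m) * fact m)"
    unfolding 1 by simp
  also have "\<dots> = - of_nat t * (P * (x + of_nat m) * (x + of_nat m + 1)) / (of_nat (Suc m) * fact m)
     + (of_nat k * of_nat (Suc k) - (b + 2 * of_nat t) * (b + 2 * of_nat t - 1)) * (P / fact m)"
    unfolding key by (simp add: divide_simps del: of_nat_Suc) (simp add: algebra_simps del: of_nat_Suc)
  finally show ?thesis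
    unfolding 2 3 .
qed

text \<open>Both sides are 1 at k = 0 and satisfy (b+k)(k+1) c_{k+1} = (a+k)(1-a+k) c_k. On the
  right this is \<open>bin_coeff_rec\<close> weighted by \<open>quad_coeff\<close> and summed over
  t: after an index shift, the part with t - 1 is absorbed by \<open>quad_coeff_Suc\<close>.\<close>

lemma quadratic_transformation_coeff:
  assumes "b \<notin> \<int>\<^sub>\<le>\<^sub>0"
  shows "pochhammer a k * pochhammer (1 - a) k / (pochhammer b k * fact k) =
    (\<Sum>t\<le>k. quad_coeff a b t * bin_coeff b k t)"
proof (induction k)
  case 0
  show ?case by (simp add: quad_coeff_def bin_coeff_def)
next
  case (Suc k)
  let ?q = "quad_coeff a b" and ?v = "bin_coeff b"
  \<comment> \<open>\<open>g\<close> and \<open>w\<close> are the two parts of the right-hand side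
    of \<open>bin_coeff_rec\<close>, weighted by \<open>quad_coeff\<close>; \<open>w\<close> is the
    part that lowers t.\<close>
  define g where "g t = (of_nat k * of_nat (Suc k) - (b + 2 * of_nat t) * (b + 2 * of_nat t - 1)) * ?q t * ?v k t" for t
  define w where "w t = of_nat t * (b + of_nat t - 1) * ?q t * ?v k (t - 1)" for t
  have w0: "w 0 = 0"
    by (simp add: w_def)
  have nz: "pochhammer b (Suc k) \<noteq> 0"
    using assms pochhammer_eq_0_imp_nonpos_Int by blast
  hence bk: "b + of_nat k \<noteq> 0"
    by (auto simp: pochhammer_Suc)
  have "(a + of_nat k) * (1 - a + of_nat k) * (\<Sum>t\<le>k. ?q t * ?v k t) = (\<Sum>t\<le>k. w (Suc t) + g t)"
    unfolding sum_distrib_left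
  proof (rule sum.cong [OF refl])
    fix t
    \<comment> \<open>The term a(1-a) is common: (a+k)(1-a+k) = a(1-a) + k(k+1) and
      (b-a+2t)(a+b-1+2t) = a(1-a) + (b+2t)(b+2t-1).\<close>
    have split: "(a + of_nat k) * (1 - a + of_nat k) =
       (b - a + 2 * of_nat t) * (a + b - 1 + 2 * of_nat t) +
       (of_nat k * of_nat (Suc k) - (b + 2 * of_nat t) * (b + 2 * of_nat t - 1))"
      by (simp add: algebra_simps)
    show "(a + of_nat k) * (1 - a + of_nat k) * (?q t * ?v k t) = w (Suc t) + g t"
    proof -
      have "w (Suc t) = (b + of_nat t) * of_nat (Suc t) * ?q (Suc t) * ?v k t"
        by (simp add: w_def mult_ac)
      then show ?thesis
        unfolding quad_coeff_Suc [OF assms] split g_def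
        by (simp only: distrib_right mult.assoc)
    qed
  qed
  also have "\<dots> = (\<Sum>t\<le>Suc k. w t) + (\<Sum>t\<le>k. g t)"
    using w0 by (simp add: sum.distrib sum.atMost_Suc_shift del: sum.atMost_Suc)
  also have "\<dots> = (\<Sum>t\<le>k. w t + g t) + w (Suc k)"
    by (simp add: sum.distrib)
  \<comment> \<open>The index t = k + 1 lies outside the range of \<open>bin_coeff_rec\<close>;
    there both \<open>bin_coeff\<close> values are 1.\<close>
  also have "w (Suc k) = (b + of_nat k) * of_nat (Suc k) * (?q (Suc k) * ?v (Suc k) (Suc k))"
    by (simp add: w_def bin_coeff_def)
  also have "(\<Sum>t\<le>k. w t + g t) = (\<Sum>t\<le>k. (b + of_nat k) * of_nat (Suc k) * (?q t * ?v (Suc k) t))"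
  proof (rule sum.cong [OF refl])
    fix t assume "t \<in> {..k}"
    hence "t \<le> k" by simp
    from bin_coeff_rec [OF this, of b]
    have "?q t * ((b + of_nat k) * of_nat (Suc k) * ?v (Suc k) t) =
      ?q t * (of_nat t * (b + of_nat t - 1) * bin_coeff b k (t - 1) +
    (of_nat k * of_nat (Suc k) - (b + 2 * of_nat t) * (b + 2 * of_nat t - 1)) * bin_coeff b k t)"
      by simp
    thus "w t + g t = (b + of_nat k) * of_nat (Suc k) * (?q t * ?v (Suc k) t)"
      unfolding w_def g_def by (simp only: distrib_left mult.assoc mult.left_commute mult.commute)
  qed
  finally have "(a + of_nat k) * (1 - a + of_nat k) * (\<Sum>t\<le>k. ?q t * ?v k t) =
      (b + of_nat k) * of_nat (Suc k) * (\<Sum>t\<le>Suc k. ?q t * ?v (Suc k) t)"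
    by (simp add: sum_distrib_left distrib_left)
  hence "(\<Sum>t\<le>Suc k. ?q t * ?v (Suc k) t) =
    (a + of_nat k) * (1 - a + of_nat k) * (\<Sum>t\<le>k. ?q t * ?v k t) / ((b + of_nat k) * of_nat (Suc k))"
    using bk by (metis no_zero_divisors nonzero_mult_div_cancel_left of_nat_neq_0)
  also have "\<dots> = pochhammer a (Suc k) * pochhammer (1 - a) (Suc k) / (pochhammer b (Suc k) * fact (Suc k))"
    unfolding Suc.IH [symmetric] pochhammer_Suc fact_Suc by (simp add: algebra_simps)
  finally show ?case by simp
qed

section \<open>Chu-Vandermonde and the case l = 0\<close>

text \<open>Terms beyond M vanish; allowing any bound K from M on lets sums with different points of
  termination share one range.\<close>

lemma Chu_Vandermonde:
  fixes c x :: complex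
  assumes "c \<notin> \<int>\<^sub>\<le>\<^sub>0" and "M \<le> K"
  shows "(\<Sum>k\<le>K. pochhammer x k * pochhammer (- of_nat M) k / (pochhammer c k * fact k)) =
    pochhammer (c - x) M / pochhammer c M"
proof -
  have "(\<Sum>k\<le>K. pochhammer x k * pochhammer (- of_nat M) k / (pochhammer c k * fact k)) =
    (\<Sum>k\<in>{0..M}. pochhammer x k * pochhammer (- of_nat M) k / (of_nat (fact k) * pochhammer c k))"
    using assms(2)
    by (intro sum.mono_neutral_cong_right) (auto simp: pochhammer_of_nat_eq_0_iff mult.commute)
  also have "\<dots> = pochhammer (c - x) M / pochhammer c M"
    using assms(1) by (intro Vandermonde_pochhammer) auto
  finally show ?thesis .
qed

text \<open>The quadratic transformation is inserted and the triangle reindexed by k = t + m; (d)_k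
  / (e)_k splits at t. This is the beta integral of each x^t (1-x)^(b-1+t), leaving an inner 2F1 at
  1.\<close>

lemma sum_eq_quadratic_double_sum:
  assumes b: "b \<notin> \<int>\<^sub>\<le>\<^sub>0" and e: "e \<notin> \<int>\<^sub>\<le>\<^sub>0"
  shows "(\<Sum>k\<le>K. pochhammer a k * pochhammer (1 - a) k / (pochhammer b k * fact k) * (pochhammer d k / pochhammer e k)) =
    (\<Sum>t\<le>K. quad_coeff a b t * (pochhammer d t / pochhammer e t) *
      (\<Sum>m\<le>K - t. pochhammer (1 - b - of_nat t) m * pochhammer (d + of_nat t) m / (pochhammer (e + of_nat t) m * fact m)))"
  (is "?l = ?r")
proof -
  define g where "g t m = quad_coeff a b t * (pochhammer (1 - b - of_nat t) m / fact m) *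
    (pochhammer d (t + m) / pochhammer e (t + m))" for t m
  have "?l = (\<Sum>k\<le>K. \<Sum>t\<le>k. g t (k - t))"
    unfolding quadratic_transformation_coeff [OF b] sum_distrib_right
    by (intro sum.cong refl) (simp add: g_def bin_coeff_def)
  also have "\<dots> = (\<Sum>(t, m)\<in>{(i, j). i + j \<le> K}. g t m)"
    by (rule sum.triangle_reindex_eq [symmetric])
  also have "{(i, j). i + j \<le> K} = Sigma {..K} (\<lambda>t. {..K - t})"
    by auto
  also have "(\<Sum>(t, m)\<in>\<dots>. g t m) = (\<Sum>t\<le>K. \<Sum>m\<le>K - t. g t m)"
    by (rule sum.Sigma [symmetric]) auto
  also have "\<dots> = ?r"
    by (intro sum.cong refl) (simp add: sum_distrib_left g_def pochhammer_product' mult_ac)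
  finally show ?thesis .
qed

lemma pochhammer_neq_0: "(x::complex) \<notin> \<int>\<^sub>\<le>\<^sub>0 \<Longrightarrow> pochhammer x n \<noteq> 0"
  using pochhammer_eq_0_imp_nonpos_Int by blast

lemma pochhammer_reflect:
  "pochhammer (1 - x) n = (- 1) ^ n * pochhammer (x - of_nat n :: complex) n"
  using pochhammer_minus [of "x - 1" n] by (simp add: algebra_simps)

lemma pochhammer_mult_swap:
  "pochhammer z n * pochhammer (z + of_nat n) m = pochhammer z m * pochhammer (z + of_nat m :: complex) n"
  by (simp only: pochhammer_product' [symmetric] add.commute)

lemma plus_nat_notin_nonpos_Ints: "(x::complex) \<notin> \<int>\<^sub>\<le>\<^sub>0 \<Longrightarrow> x + of_nat n \<notin> \<int>\<^sub>\<le>\<^sub>0"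
  using nonpos_Ints_diff_Nats [of "x + of_nat n" "of_nat n"] by auto

text \<open>For t > N the factor (d)_t is zero; otherwise d + t = -(N-t) terminates the inner sum
  and Chu-Vandermonde evaluates it.\<close>

lemma quadratic_sum_upper_nat:
  assumes b: "b \<notin> \<int>\<^sub>\<le>\<^sub>0" and e: "e \<notin> \<int>\<^sub>\<le>\<^sub>0" and eb: "e + b - 1 \<notin> \<int>\<^sub>\<le>\<^sub>0" and "N \<le> K"
  defines "d \<equiv> - of_nat N"
  shows "(\<Sum>k\<le>K. pochhammer a k * pochhammer (1 - a) k / (pochhammer b k * fact k) * (pochhammer d k / pochhammer e k)) =
    pochhammer (e + b - 1) N / pochhammer e N *
    (\<Sum>t\<le>K. quad_coeff a b t * (pochhammer d t * pochhammer (e + b - 1 - d) t / pochhammer (e + b - 1) (2 * t)))"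
proof -
  have sum_term: "quad_coeff a b t * (pochhammer d t / pochhammer e t) *
      (\<Sum>m\<le>K - t. pochhammer (1 - b - of_nat t) m * pochhammer (d + of_nat t) m / (pochhammer (e + of_nat t) m * fact m)) =
    pochhammer (e + b - 1) N / pochhammer e N *
      (quad_coeff a b t * (pochhammer d t * pochhammer (e + b - 1 - d) t / pochhammer (e + b - 1) (2 * t)))" for t
  proof (cases "t \<le> N")
    case False
    then have "pochhammer d t = 0"
      by (simp add: d_def pochhammer_of_nat_eq_0_iff)
    then show ?thesis by simp
  next
    case True
    then obtain M where N: "N = t + M"
      using le_Suc_ex by blast
    have d: "d + of_nat t = - of_nat M"
      by (simp add: d_def N)
    define I where "I = (\<Sum>m\<le>K - t. pochhammer (1 - b - of_nat t) m * pochhammer (d + of_nat t) m /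
      (pochhammer (e + of_nat t) m * fact m))"
    define Q where "Q = pochhammer (e + of_nat t - (1 - b - of_nat t)) M"
    have "I = Q / pochhammer (e + of_nat t) M"
      unfolding I_def Q_def d using e \<open>N \<le> K\<close> N by (intro Chu_Vandermonde plus_nat_notin_nonpos_Ints) auto
    moreover have "pochhammer e N = pochhammer e t * pochhammer (e + of_nat t) M"
      by (simp add: N pochhammer_product')
    moreover have "Q * pochhammer (e + b - 1) (2 * t) =
        pochhammer (e + b - 1) N * pochhammer (e + b - 1 - d) t"
    proof -
      \<comment> \<open>With s = e + b - 1 both sides are (s)_{N+t}, because 2t + M = N + t.\<close>
      have "pochhammer (e + b - 1) (2 * t) * pochhammer (e + b - 1 + of_nat (2 * t)) M =
        pochhammer (e + b - 1) N * pochhammer (e + b - 1 + of_nat N) t"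
        by (simp only: pochhammer_product' [symmetric]) (simp add: N mult_2 add_ac)
      then show ?thesis by (simp add: Q_def d_def algebra_simps)
    qed
    moreover have "pochhammer e N \<noteq> 0" "pochhammer (e + b - 1) (2 * t) \<noteq> 0"
      using e eb by (simp_all add: pochhammer_neq_0)
    ultimately have "pochhammer d t / pochhammer e t * I = pochhammer (e + b - 1) N / pochhammer e N *
      (pochhammer d t * pochhammer (e + b - 1 - d) t / pochhammer (e + b - 1) (2 * t))"
      by (simp add: divide_simps) (simp add: mult.assoc [symmetric])
    then show ?thesis
      unfolding I_def [symmetric] by (simp only: mult.assoc mult.left_commute)
  qed
  show ?thesis
    unfolding sum_eq_quadratic_double_sum [OF b e]
    by (intro trans [OF _ sum_distrib_left [symmetric]] sum.cong refl sum_term)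
qed

text \<open>Here d is arbitrary and 1 - b - t = -(B+t) terminates the inner sum. Only t \<le> m
  contribute, and then B + 2m \<le> K leaves room for all B + t + 1 terms below K - t.\<close>

lemma quadratic_sum_lower_nat:
  assumes e: "e \<notin> \<int>\<^sub>\<le>\<^sub>0" and K: "B + 2 * m \<le> K" and m: "\<And>t. t > m \<Longrightarrow> quad_coeff a b t = 0"
    and b_def: "b = of_nat B + 1"
  shows "(\<Sum>k\<le>K. pochhammer a k * pochhammer (1 - a) k / (pochhammer b k * fact k) * (pochhammer d k / pochhammer e k)) =
    pochhammer (e - d) B / pochhammer e B *
    (\<Sum>t\<le>K. quad_coeff a b t * (pochhammer d t * pochhammer (e + b - 1 - d) t / pochhammer (e + b - 1) (2 * t)))"
proof -
  have b: "b \<notin> \<int>\<^sub>\<le>\<^sub>0"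
    using plus_nat_notin_nonpos_Ints [of 1 B] by (simp add: b_def add.commute)
  have sum_term: "quad_coeff a b t * (pochhammer d t / pochhammer e t) *
      (\<Sum>m\<le>K - t. pochhammer (1 - b - of_nat t) m * pochhammer (d + of_nat t) m / (pochhammer (e + of_nat t) m * fact m)) =
    pochhammer (e - d) B / pochhammer e B *
      (quad_coeff a b t * (pochhammer d t * pochhammer (e + b - 1 - d) t / pochhammer (e + b - 1) (2 * t)))" for t
  proof (cases "t \<le> m")
    case False
    then show ?thesis by (simp add: m)
  next
    case True
    have bt: "1 - b - of_nat t = - of_nat (B + t)"
      by (simp add: b_def)
    have "(\<Sum>m\<le>K - t. pochhammer (1 - b - of_nat t) m * pochhammer (d + of_nat t) m / (pochhammer (e + of_nat t) m * fact m)) =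
      (\<Sum>m\<le>K - t. pochhammer (d + of_nat t) m * pochhammer (1 - b - of_nat t) m / (pochhammer (e + of_nat t) m * fact m))"
      by (simp only: mult.commute)
    also have "\<dots> = pochhammer (e + of_nat t - (d + of_nat t)) (B + t) / pochhammer (e + of_nat t) (B + t)"
      unfolding bt using e K True by (intro Chu_Vandermonde plus_nat_notin_nonpos_Ints) auto
    also have "pochhammer (e + of_nat t - (d + of_nat t)) (B + t) = pochhammer (e - d) B * pochhammer (e + b - 1 - d) t"
      by (simp add: pochhammer_product' b_def algebra_simps)
    finally have "(\<Sum>m\<le>K - t. pochhammer (1 - b - of_nat t) m * pochhammer (d + of_nat t) m / (pochhammer (e + of_nat t) m * fact m)) =
      pochhammer (e - d) B * pochhammer (e + b - 1 - d) t / pochhammer (e + of_nat t) (B + t)" .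
    \<comment> \<open>Both sides are (e)_{B+2t}.\<close>
    moreover have "pochhammer e t * pochhammer (e + of_nat t) (B + t) = pochhammer e B * pochhammer (e + b - 1) (2 * t)"
    proof -
      have "e + b - 1 = e + of_nat B"
        by (simp add: b_def)
      then show ?thesis
        by (simp only: pochhammer_product' [symmetric]) (simp add: mult_2 add_ac)
    qed
    moreover have "pochhammer e t \<noteq> 0" "pochhammer (e + of_nat t) (B + t) \<noteq> 0"
      using e by (simp_all add: pochhammer_neq_0 plus_nat_notin_nonpos_Ints)
    ultimately have "pochhammer d t / pochhammer e t *
      (\<Sum>m\<le>K - t. pochhammer (1 - b - of_nat t) m * pochhammer (d + of_nat t) m / (pochhammer (e + of_nat t) m * fact m)) =
      pochhammer (e - d) B / pochhammer e B *
       (pochhammer d t * pochhammer (e + b - 1 - d) t / pochhammer (e + b - 1) (2 * t))"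
      by (simp add: mult_ac)
    then show ?thesis
      by (simp only: mult.assoc mult.left_commute)
  qed
  show ?thesis
    unfolding sum_eq_quadratic_double_sum [OF b e]
    by (intro trans [OF _ sum_distrib_left [symmetric]] sum.cong refl sum_term)
qed

section \<open>Newton expansion at the nodes -d, -d-1, ..\<close>

text \<open>Since (-j)_k / k! = (-1)^k binom(j,k) and (-k)_i is a signed falling factorial of k,
  this is, up to sign, a j-th finite difference at 0: the functional dual to the Newton
  basis.\<close>

lemma alternating_sum_pochhammer:
  "(\<Sum>k\<le>j. pochhammer (- of_nat j) k / fact k * pochhammer (- of_nat k) i) =
    (if i = j then fact j else 0 :: complex)"
proof (cases "i \<le> j")
  case False
  then show ?thesis
    by (auto intro!: sum.neutral simp: pochhammer_of_nat_eq_0_iff)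
next
  case True
  then obtain M where j: "j = i + M"
    using le_Suc_ex by blast
  let ?f = "\<lambda>k. pochhammer (- of_nat j) k / fact k * pochhammer (- of_nat k) i :: complex"
  have "(\<Sum>k\<le>j. ?f k) = (\<Sum>k\<in>{i..j}. ?f k)"
    by (rule sum.mono_neutral_right) (auto simp: pochhammer_of_nat_eq_0_iff)
  also have "\<dots> = (\<Sum>m\<le>M. ?f (i + m))"
    by (rule sum.reindex_bij_witness [of _ "\<lambda>m. i + m" "\<lambda>k. k - i"]) (auto simp: j)
  \<comment> \<open>The factor (1)_m is inserted above and below so that Chu-Vandermonde applies
    with both parameters 1; its value (0)_M / (1)_M is zero unless M = 0, that is i = j.\<close>
  also have "\<dots> = (\<Sum>m\<le>M. (- 1) ^ i * pochhammer (- of_nat j) i *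
      (pochhammer 1 m * pochhammer (- of_nat M) m / (pochhammer 1 m * fact m)))"
  proof (rule sum.cong [OF refl])
    fix m
    have "pochhammer (- of_nat (i + m)) i = (- 1) ^ i * pochhammer (1 + of_nat m :: complex) i"
      using pochhammer_minus [of "of_nat (i + m) :: complex" i] by (simp add: add.commute)
    moreover have "fact m * pochhammer (1 + of_nat m :: complex) i = fact (i + m)"
      using pochhammer_product' [of "1 :: complex" m i]
      by (simp add: pochhammer_fact add.commute)
    ultimately have 1: "fact m * pochhammer (- of_nat (i + m)) i = (- 1) ^ i * (fact (i + m) :: complex)"
      by (metis mult.left_commute)
    have 2: "pochhammer (- of_nat j) (i + m) =
        pochhammer (- of_nat j) i * pochhammer (- of_nat M :: complex) m"
      by (simp add: pochhammer_product' j)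
    have "?f (i + m) = pochhammer (- of_nat j) (i + m) / (fact (i + m) * fact m) *
       (fact m * pochhammer (- of_nat (i + m)) i)"
      by simp
    also have "\<dots> = (- 1) ^ i * pochhammer (- of_nat j) i *
      (pochhammer 1 m * pochhammer (- of_nat M) m / (pochhammer 1 m * fact m))"
      unfolding 1 2 by (simp add: pochhammer_fact [symmetric])
    finally show "?f (i + m) = (- 1) ^ i * pochhammer (- of_nat j) i *
      (pochhammer 1 m * pochhammer (- of_nat M) m / (pochhammer 1 m * fact m))" .
  qed
  also have "\<dots> = (- 1) ^ i * pochhammer (- of_nat j) i * (pochhammer 0 M / pochhammer 1 M)"
    unfolding sum_distrib_left [symmetric] by (subst Chu_Vandermonde) auto
  also have "\<dots> = (if i = j then fact j else 0)"
    by (auto simp: j pochhammer_0_left pochhammer_same)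
  finally show ?thesis .
qed

definition newton_expansion :: "complex \<Rightarrow> nat \<Rightarrow> (complex \<Rightarrow> complex) \<Rightarrow> (nat \<Rightarrow> complex) \<Rightarrow> bool" where
  "newton_expansion d n f \<gamma> \<longleftrightarrow> (\<forall>x. f x = (\<Sum>j\<le>n. \<gamma> j * pochhammer (x + d) j))"

text \<open>Write h + x = (x + d + j) + (h - d - j): the first summand raises the j-th basis
  polynomial to the next, the second only rescales it.\<close>

lemma newton_expansion_linear_factor:
  assumes "newton_expansion d n f \<gamma>"
  shows "\<exists>\<gamma>'. newton_expansion d (Suc n) (\<lambda>x. (h + x) * f x) \<gamma>'"
proof (intro exI)
  \<comment> \<open>\<open>u\<close> holds the raised terms, with index shifted by one;
    \<open>v\<close> holds the rescaled ones, extended by 0 to j = n + 1.\<close>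
  define u where "u j = (if j = 0 then 0 else \<gamma> (j - 1))" for j
  define v where "v j = (if j \<le> n then \<gamma> j * (h - d - of_nat j) else 0)" for j
  show "newton_expansion d (Suc n) (\<lambda>x. (h + x) * f x) (\<lambda>j. u j + v j)"
    unfolding newton_expansion_def
  proof
    fix x
    have f: "f x = (\<Sum>j\<le>n. \<gamma> j * pochhammer (x + d) j)"
      using assms by (simp add: newton_expansion_def)
    have "(h + x) * f x = (\<Sum>j\<le>n. u (Suc j) * pochhammer (x + d) (Suc j) + v j * pochhammer (x + d) j)"
      unfolding f sum_distrib_left
      by (intro sum.cong refl) (simp add: u_def v_def pochhammer_Suc algebra_simps)
    also have "\<dots> = (\<Sum>j\<le>Suc n. u j * pochhammer (x + d) j) + (\<Sum>j\<le>Suc n. v j * pochhammer (x + d) j)"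
      using sum.atMost_Suc_shift [of "\<lambda>j. u j * pochhammer (x + d) j" n]
      by (simp add: sum.distrib u_def v_def)
    finally show "(h + x) * f x = (\<Sum>j\<le>Suc n. (u j + v j) * pochhammer (x + d) j)"
      by (simp add: sum.distrib distrib_right)
  qed
qed

lemma newton_expansion_pochhammer_factor:
  assumes "newton_expansion d n f \<gamma>"
  shows "\<exists>\<gamma>'. newton_expansion d (q + n) (\<lambda>x. pochhammer (h + x) q * f x) \<gamma>'"
proof (induction q)
  case 0
  then show ?case using assms by auto
next
  case (Suc q)
  then obtain \<gamma>' where "newton_expansion d (q + n) (\<lambda>x. pochhammer (h + x) q * f x) \<gamma>'"
    by blast
  from newton_expansion_linear_factor [OF this, of "h + of_nat q"] show ?case
    by (simp add: pochhammer_Suc mult_ac add_ac)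
qed

lemma newton_expansion_vpoch_vec:
  assumes "length hs = length ps"
  shows "\<exists>\<gamma>. newton_expansion d (sum_list ps) (\<lambda>x. vpoch_vec (map (\<lambda>h. h + x) hs) ps) \<gamma>"
  using assms
proof (induction hs ps rule: list_induct2)
  case Nil
  have "newton_expansion d 0 (\<lambda>x. 1) (\<lambda>j. 1)"
    by (simp add: newton_expansion_def)
  then show ?case by (auto simp: vpoch_vec_def)
next
  case (Cons h hs q ps)
  then obtain \<gamma> where "newton_expansion d (sum_list ps) (\<lambda>x. vpoch_vec (map (\<lambda>h. h + x) hs) ps) \<gamma>"
    by blast
  from newton_expansion_pochhammer_factor [OF this, of q h] show ?case
    by (simp add: vpoch_vec_def)
qed

text \<open>At the node x = -d - k the basis polynomial (x + d)_i becomes (-k)_i, so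
  \<open>alternating_sum_pochhammer\<close> isolates i = j.\<close>

lemma newton_expansion_coeff:
  assumes "newton_expansion d n f \<gamma>" and "j \<le> n"
  shows "(\<Sum>k\<le>j. pochhammer (- of_nat j) k / fact k * f (- d - of_nat k)) = fact j * \<gamma> j"
proof -
  have "(\<Sum>k\<le>j. pochhammer (- of_nat j) k / fact k * f (- d - of_nat k)) =
    (\<Sum>k\<le>j. \<Sum>i\<le>n. \<gamma> i * (pochhammer (- of_nat j) k / fact k * pochhammer (- of_nat k) i))"
    using assms(1) by (simp add: newton_expansion_def sum_distrib_left mult_ac)
  also have "\<dots> = (\<Sum>i\<le>n. \<gamma> i * (if i = j then fact j else 0))"
    by (subst sum.swap) (simp only: sum_distrib_left [symmetric] alternating_sum_pochhammer)
  also have "\<dots> = fact j * \<gamma> j"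
    using assms(2) by (simp add: if_distrib [of "\<lambda>x. _ * x"] sum.delta mult.commute cong: if_cong)
  finally show ?thesis .
qed

section \<open>Parameter vectors and the polynomial Y_p\<close>

text \<open>Componentwise (h)_q (h+q)_k = (h)_k (h+k)_q. It trades the parameters h + p over h for
  the polynomial prod_i (h_i + x)_{p_i} at x = k.\<close>

lemma vpoch_shift_mult_vpoch_vec:
  assumes "length hs = length ps"
  shows "vpoch (map2 (\<lambda>h q. h + of_nat q) hs ps) k * vpoch_vec hs ps =
    vpoch hs k * vpoch_vec (map (\<lambda>h. h + of_nat k) hs) ps"
  using assms
proof (induction hs ps rule: list_induct2)
  case Nil
  then show ?case by (simp add: vpoch_vec_def)
next
  case (Cons h hs q ps)
  have "pochhammer h q * pochhammer (h + of_nat q) k = pochhammer h k * pochhammer (h + of_nat k) q"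
    by (rule pochhammer_mult_swap)
  moreover have "vpoch (map2 (\<lambda>h q. h + of_nat q) (h # hs) (q # ps)) k * vpoch_vec (h # hs) (q # ps) =
      (pochhammer h q * pochhammer (h + of_nat q) k) *
      (vpoch (map2 (\<lambda>h q. h + of_nat q) hs ps) k * vpoch_vec hs ps)"
    by (simp add: vpoch_def vpoch_vec_def mult_ac)
  moreover have "vpoch (h # hs) k * vpoch_vec (map (\<lambda>h. h + of_nat k) (h # hs)) (q # ps) =
      (pochhammer h k * pochhammer (h + of_nat k) q) *
      (vpoch hs k * vpoch_vec (map (\<lambda>h. h + of_nat k) hs) ps)"
    by (simp add: vpoch_def vpoch_vec_def mult_ac)
  ultimately show ?case
    using Cons.IH by simp
qed

text \<open>Componentwise, reflecting (h-d)_q and (h-d-k)_q produces the same sign, and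
  \<open>pochhammer_mult_swap\<close> does the rest. It turns terms of the inner series of Y_p into
  values of prod_i (h_i + x)_{p_i} at the Newton nodes x = -d - k.\<close>

lemma vpoch_Y_lower_mult_vpoch_vec:
  assumes "length hs = length ps"
  shows "vpoch (Y_upper hs d) k * vpoch_vec (map (\<lambda>h. h - d) hs) ps =
    vpoch (Y_lower hs ps d) k * vpoch_vec (map (\<lambda>h. h + (- d - of_nat k)) hs) ps"
  using assms
proof (induction hs ps rule: list_induct2)
  case Nil
  then show ?case by (simp add: vpoch_vec_def vpoch_def Y_upper_def Y_lower_def)
next
  case (Cons h hs q ps)
  let ?x = "1 - h + d - of_nat q"
  have "pochhammer (1 - h + d) k * pochhammer (h - d) q = pochhammer ?x k * pochhammer (h + (- d - of_nat k)) q"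
  proof -
    have "pochhammer (h - d) q = (- 1) ^ q * pochhammer ?x q"
      using pochhammer_reflect [of "1 - h + d" q] by (simp add: algebra_simps)
    moreover have "pochhammer (h + (- d - of_nat k)) q = (- 1) ^ q * pochhammer (?x + of_nat k) q"
      using pochhammer_reflect [of "1 - h + d + of_nat k" q] by (simp add: algebra_simps)
    moreover have "pochhammer ?x q * pochhammer (?x + of_nat q) k = pochhammer ?x k * pochhammer (?x + of_nat k) q"
      by (rule pochhammer_mult_swap)
    ultimately show ?thesis
      by (simp add: mult_ac)
  qed
  moreover have "vpoch (Y_upper (h # hs) d) k * vpoch_vec (map (\<lambda>h. h - d) (h # hs)) (q # ps) =
      (pochhammer (1 - h + d) k * pochhammer (h - d) q) *
      (vpoch (Y_upper hs d) k * vpoch_vec (map (\<lambda>h. h - d) hs) ps)"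
    by (simp add: vpoch_def vpoch_vec_def Y_upper_def mult_ac)
  moreover have "vpoch (Y_lower (h # hs) (q # ps) d) k * vpoch_vec (map (\<lambda>h. h + (- d - of_nat k)) (h # hs)) (q # ps) =
      (pochhammer ?x k * pochhammer (h + (- d - of_nat k)) q) *
      (vpoch (Y_lower hs ps d) k * vpoch_vec (map (\<lambda>h. h + (- d - of_nat k)) hs) ps)"
    by (simp add: vpoch_def vpoch_vec_def Y_lower_def mult_ac)
  ultimately show ?case
    using Cons.IH by simp
qed

lemma vpoch_neq_0: "admissible_lower bs \<Longrightarrow> vpoch bs n \<noteq> 0"
  using pochhammer_neq_0 by (fastforce simp: admissible_lower_def vpoch_def prod_list_zero_iff)

lemma hyp_P_eq_sum:
  assumes "\<And>n. n > K \<Longrightarrow> vpoch as n = 0"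
  shows "hyp_P as bs P = (\<Sum>n\<le>K. vpoch as n / (vpoch bs n * fact n) * P (of_nat n))"
  unfolding hyp_P_def by (rule suminf_finite) (use assms in \<open>auto simp: not_le\<close>)

lemma vpoch_vec_mult_hyp_Y:
  assumes "length hs = length ps" and "admissible_lower (Y_lower hs ps d)"
    and "newton_expansion d (sum_list ps) (\<lambda>x. vpoch_vec (map (\<lambda>h. h + x) hs) ps) \<gamma>"
    and "j \<le> sum_list ps"
  shows "vpoch_vec (map (\<lambda>h. h - d) hs) ps * hyp (- of_nat j # Y_upper hs d) (Y_lower hs ps d) =
    fact j * \<gamma> j"
proof -
  have "hyp (- of_nat j # Y_upper hs d) (Y_lower hs ps d) =
      (\<Sum>k\<le>j. vpoch (- of_nat j # Y_upper hs d) k / (vpoch (Y_lower hs ps d) k * fact k))"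
    unfolding hyp_def
    by (subst hyp_P_eq_sum [of j]) (auto simp: vpoch_def pochhammer_of_nat_eq_0_iff)
  also have "vpoch_vec (map (\<lambda>h. h - d) hs) ps * \<dots> =
    (\<Sum>k\<le>j. pochhammer (- of_nat j) k / fact k * vpoch_vec (map (\<lambda>h. h + (- d - of_nat k)) hs) ps)"
    unfolding sum_distrib_left
  proof (rule sum.cong [OF refl])
    fix k
    have nz: "vpoch (Y_lower hs ps d) k \<noteq> 0"
      using assms(2) by (rule vpoch_neq_0)
    have c: "vpoch (- of_nat j # Y_upper hs d) k = pochhammer (- of_nat j) k * vpoch (Y_upper hs d) k"
      by (simp add: vpoch_def)
    show "vpoch_vec (map (\<lambda>h. h - d) hs) ps *
        (vpoch (- of_nat j # Y_upper hs d) k / (vpoch (Y_lower hs ps d) k * fact k)) =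
      pochhammer (- of_nat j) k / fact k * vpoch_vec (map (\<lambda>h. h + (- d - of_nat k)) hs) ps"
      using vpoch_Y_lower_mult_vpoch_vec [OF assms(1), of d k] nz unfolding c
      by (simp add: field_simps)
  qed
  also have "\<dots> = fact j * \<gamma> j"
    using newton_expansion_coeff [OF assms(3,4)] .
  finally show ?thesis .
qed

lemma Y_poly_newton:
  assumes "length hs = length ps" and "admissible_lower (Y_lower hs ps d)"
    and "newton_expansion d (sum_list ps) (\<lambda>x. vpoch_vec (map (\<lambda>h. h + x) hs) ps) \<gamma>"
  shows "Y_poly hs ps d e lam u v t = (\<Sum>j\<le>sum_list ps. \<gamma> j * (pochhammer (d - e + 1) j *
    pochhammer (u * t + d) j * pochhammer (v * t + d - e - lam + of_nat j + 1) (sum_list ps - j))) / Gamma (e - d)"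
proof -
  have "Y_poly hs ps d e lam u v t = (\<Sum>j\<le>sum_list ps.
      (vpoch_vec (map (\<lambda>h. h - d) hs) ps * hyp (- of_nat j # Y_upper hs d) (Y_lower hs ps d)) *
      (pochhammer (d - e + 1) j / fact j *
      pochhammer (u * t + d) j * pochhammer (v * t + d - e - lam + of_nat j + 1) (sum_list ps - j))) / Gamma (e - d)"
    by (simp add: Y_poly_def atMost_atLeast0 sum_distrib_left sum_divide_distrib mult_ac)
  also have "\<dots> = (\<Sum>j\<le>sum_list ps. (fact j * \<gamma> j) *
      (pochhammer (d - e + 1) j / fact j *
      pochhammer (u * t + d) j * pochhammer (v * t + d - e - lam + of_nat j + 1) (sum_list ps - j))) / Gamma (e - d)"
    using assms by (intro arg_cong2 [where f = "(/)"] sum.cong refl) (simp add: vpoch_vec_mult_hyp_Y)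
  finally show ?thesis
    by (simp add: mult_ac)
qed

section \<open>The contribution of a single Newton basis polynomial\<close>

text \<open>With s = e + b - d - 1, this merges the upper parameter s - p of the right-hand series
  with the last factor of the j-th summand of Y_p, giving the parameter s - j of the case d + j. The
  two reflections of length p - j carry the same sign.\<close>

lemma pochhammer_ratio:
  fixes s :: complex
  assumes "pochhammer (1 - s) p \<noteq> 0" and "j \<le> p"
  shows "pochhammer (s - of_nat p) t * pochhammer (1 - s - of_nat t + of_nat j) (p - j) / pochhammer (1 - s) p =
    pochhammer (s - of_nat j) t / pochhammer (1 - s) j"
proof -
  obtain q where p: "p = j + q"
    using assms(2) le_Suc_ex by blast
  have 1: "pochhammer (1 - s - of_nat t + of_nat j) q = (- 1) ^ q * pochhammer (s - of_nat p + of_nat t) q"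
    using pochhammer_reflect [of "s + of_nat t - of_nat j" q] by (simp add: p algebra_simps)
  have 2: "pochhammer (1 - s) p = pochhammer (1 - s) j * ((- 1) ^ q * pochhammer (s - of_nat p) q)"
    using pochhammer_reflect [of "s - of_nat j" q] by (simp add: p pochhammer_product' algebra_simps)
  have 3: "pochhammer (s - of_nat p) t * pochhammer (s - of_nat p + of_nat t) q =
      pochhammer (s - of_nat p) q * pochhammer (s - of_nat p + of_nat q) t"
    by (rule pochhammer_mult_swap)
  have 4: "s - of_nat p + of_nat q = s - of_nat j"
    by (simp add: p)
  have 5: "p - j = q"
    by (simp add: p)
  have nz: "pochhammer (1 - s) j \<noteq> 0" "pochhammer (s - of_nat p) q \<noteq> 0"
    using assms(1) unfolding 2 by auto
  have "pochhammer (s - of_nat p) t * ((- 1) ^ q * pochhammer (s - of_nat p + of_nat t) q) =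
    (- 1) ^ q * (pochhammer (s - of_nat p) q * pochhammer (s - of_nat j) t)"
    using 3 unfolding 4 by (simp add: mult_ac)
  then show ?thesis
    unfolding 5 1 2 using nz by (simp add: divide_simps)
qed

text \<open>The contribution of the Newton basis polynomial \<open>(x + d)\<^sub>j\<close> to the theorem.\<close>

definition shifted_identity :: "complex \<Rightarrow> complex \<Rightarrow> complex \<Rightarrow> complex \<Rightarrow> nat \<Rightarrow> nat \<Rightarrow> bool" where
  "shifted_identity a b d e K j \<longleftrightarrow>
    pochhammer d j * (\<Sum>k\<le>K. pochhammer a k * pochhammer (1 - a) k / (pochhammer b k * fact k) *
      (pochhammer (d + of_nat j) k / pochhammer e k)) =
    Gamma (e + b - d - 1) * Gamma e / (Gamma (e + b - 1) * Gamma (e - d)) *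
      (pochhammer (d - e + 1) j / pochhammer (2 - e - b + d) j) *
    (pochhammer d j * (\<Sum>t\<le>K. quad_coeff a b t * (pochhammer (d + of_nat j) t *
      pochhammer (e + b - d - 1 - of_nat j) t / pochhammer (e + b - 1) (2 * t))))"

lemma Gamma_plus_nat:
  "(z::complex) \<notin> \<int>\<^sub>\<le>\<^sub>0 \<Longrightarrow> Gamma (z + of_nat n) = pochhammer z n * Gamma z"
  by (simp add: pochhammer_Gamma Gamma_eq_zero_iff)

text \<open>For j > n both sides contain (d)_j = 0. Otherwise d + j = -(n-j), so
  \<open>quadratic_sum_upper_nat\<close> applies with N = n - j, and the Gamma and Pochhammer
  quotients collapse to (e+b-1)_N / (e)_N. The bound n serves every j.\<close>

lemma shifted_identity_upper_nat:
  assumes b: "b \<notin> \<int>\<^sub>\<le>\<^sub>0" and e: "e \<notin> \<int>\<^sub>\<le>\<^sub>0" and eb: "e + b - 1 \<notin> \<int>\<^sub>\<le>\<^sub>0"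
    and d: "d = - of_nat n"
  shows "shifted_identity a b d e n j"
proof (cases "j \<le> n")
  case False
  then have "pochhammer d j = 0"
    by (simp add: d pochhammer_of_nat_eq_0_iff)
  then show ?thesis by (simp add: shifted_identity_def)
next
  case True
  then obtain N where n: "n = N + j"
    using le_Suc_ex add.commute by metis
  have dj: "d + of_nat j = - of_nat N"
    by (simp add: d n)
  have G1: "Gamma (e + b - d - 1) = pochhammer (e + b - 1) n * Gamma (e + b - 1)"
    using Gamma_plus_nat [OF eb, of n] by (simp add: d algebra_simps)
  have G2: "Gamma (e - d) = pochhammer e n * Gamma e"
    using Gamma_plus_nat [OF e, of n] by (simp add: d)
  have r1: "pochhammer (d - e + 1) j = (- 1) ^ j * pochhammer (e + of_nat N) j"
    using pochhammer_reflect [of "e - d" j] by (simp add: d n algebra_simps)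
  have r2: "pochhammer (2 - e - b + d) j = (- 1) ^ j * pochhammer (e + b - 1 + of_nat N) j"
    using pochhammer_reflect [of "e + b - d - 1" j] by (simp add: d n algebra_simps)
  have nz: "pochhammer (e + of_nat N) j \<noteq> 0" "pochhammer (e + b - 1 + of_nat N) j \<noteq> 0" "pochhammer e N \<noteq> 0"
     "Gamma e \<noteq> 0" "Gamma (e + b - 1) \<noteq> 0"
    using e eb by (simp_all add: pochhammer_neq_0 plus_nat_notin_nonpos_Ints Gamma_eq_zero_iff)
  have ratio: "Gamma (e + b - d - 1) * Gamma e / (Gamma (e + b - 1) * Gamma (e - d)) *
      (pochhammer (d - e + 1) j / pochhammer (2 - e - b + d) j) = pochhammer (e + b - 1) N / pochhammer e N"
    unfolding G1 G2 r1 r2 n pochhammer_product' using nz by (simp add: field_simps)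
  have eq: "e + b - 1 - (d + of_nat j) = e + b - d - 1 - of_nat j"
    by simp
  have "N \<le> n"
    by (simp add: n)
  note sum = quadratic_sum_upper_nat [OF b e eb this, of a, folded dj, unfolded eq]
  show ?thesis
    unfolding shifted_identity_def ratio sum by (rule mult.left_commute)
qed

text \<open>As b - 1 = B, the Gamma quotient is (e-d)_B / (e)_B; the quotient of the two j-fold
  Pochhammer symbols moves e - d to e - d - j, which is the prefactor of
  \<open>quadratic_sum_lower_nat\<close> at d + j.\<close>

lemma shifted_identity_lower_nat:
  assumes e: "e \<notin> \<int>\<^sub>\<le>\<^sub>0" and ed: "e - d \<notin> \<int>\<^sub>\<le>\<^sub>0"
    and K: "B + 2 * m \<le> K" and m: "\<And>t. t > m \<Longrightarrow> quad_coeff a b t = 0"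
    and b: "b = of_nat B + 1"
    and nz: "pochhammer (2 - e - b + d) j \<noteq> 0"
  shows "shifted_identity a b d e K j"
proof -
  define c where "c = e - d"
  have G1: "Gamma (e + b - d - 1) = pochhammer c B * Gamma c"
    using Gamma_plus_nat [OF ed, of B] by (simp add: b c_def algebra_simps)
  have G2: "Gamma (e + b - 1) = pochhammer e B * Gamma e"
    using Gamma_plus_nat [OF e, of B] by (simp add: b)
  have r1: "pochhammer (d - e + 1) j = (- 1) ^ j * pochhammer (c - of_nat j) j"
    using pochhammer_reflect [of c j] by (simp add: c_def algebra_simps)
  have r2: "pochhammer (2 - e - b + d) j = (- 1) ^ j * pochhammer (c - of_nat j + of_nat B) j"
    using pochhammer_reflect [of "c + of_nat B" j] by (simp add: c_def b algebra_simps)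
  have sw: "pochhammer (c - of_nat j) j * pochhammer c B =
      pochhammer (c - of_nat j) B * pochhammer (c - of_nat j + of_nat B) j"
    using pochhammer_mult_swap [of "c - of_nat j" j B] by simp
  have nz': "pochhammer (c - of_nat j + of_nat B) j \<noteq> 0" "pochhammer e B \<noteq> 0" "Gamma e \<noteq> 0" "Gamma c \<noteq> 0"
    using nz e ed unfolding r2 by (simp_all add: pochhammer_neq_0 Gamma_eq_zero_iff c_def)
  have "Gamma (e + b - d - 1) * Gamma e / (Gamma (e + b - 1) * Gamma (e - d)) *
      (pochhammer (d - e + 1) j / pochhammer (2 - e - b + d) j) =
     pochhammer (c - of_nat j) j * pochhammer c B / (pochhammer e B * pochhammer (c - of_nat j + of_nat B) j)"
    unfolding G1 G2 r1 r2 c_def [symmetric] using nz' by (simp add: field_simps)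
  also have "\<dots> = pochhammer (c - of_nat j) B / pochhammer e B"
    unfolding sw using nz' by simp
  also have "c - of_nat j = e - (d + of_nat j)"
    by (simp add: c_def)
  finally have ratio: "Gamma (e + b - d - 1) * Gamma e / (Gamma (e + b - 1) * Gamma (e - d)) *
      (pochhammer (d - e + 1) j / pochhammer (2 - e - b + d) j) =
      pochhammer (e - (d + of_nat j)) B / pochhammer e B" .
  have eq: "e + b - 1 - (d + of_nat j) = e + b - d - 1 - of_nat j"
    by simp
  have sum: "(\<Sum>k\<le>K. pochhammer a k * pochhammer (1 - a) k / (pochhammer b k * fact k) *
      (pochhammer (d + of_nat j) k / pochhammer e k)) =
    pochhammer (e - (d + of_nat j)) B / pochhammer e B *
    (\<Sum>t\<le>K. quad_coeff a b t * (pochhammer (d + of_nat j) t *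
      pochhammer (e + b - d - 1 - of_nat j) t / pochhammer (e + b - 1) (2 * t)))"
    unfolding eq [symmetric] using m by (rule quadratic_sum_lower_nat [OF e K _ b])
  show ?thesis
    unfolding shifted_identity_def ratio sum by (rule mult.left_commute)
qed

section \<open>Comparison of Newton coefficients\<close>

text \<open>Truncated at K, both series become finite double sums. Exchanging summations writes each
  as a combination of the Newton coefficients \<open>\<gamma> j\<close>, and
  \<open>shifted_identity\<close> equates the terms for each j.\<close>

lemma hypergeometric_identity_of_shifted:
  assumes len: "length hs = length ps"
    and b: "b \<notin> \<int>\<^sub>\<le>\<^sub>0" and e: "e \<notin> \<int>\<^sub>\<le>\<^sub>0" and hs: "admissible_lower hs"
    and Y: "admissible_lower (Y_lower hs ps d)"
    and nz: "pochhammer (2 - e - b + d) (sum_list ps) \<noteq> 0" "vpoch_vec hs ps \<noteq> 0"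
    and left: "\<And>k. k > K \<Longrightarrow> pochhammer a k * pochhammer (1 - a) k * pochhammer d k = 0"
    and right: "\<And>t. t > K \<Longrightarrow> quad_coeff a b t * pochhammer d t = 0"
    and shifted: "\<And>j. j \<le> sum_list ps \<Longrightarrow> shifted_identity a b d e K j"
  shows "hyp ([a, 1 - a, d] @ map2 (\<lambda>h q. h + of_nat q) hs ps) ([b, e] @ hs) =
      Gamma (e + b - d - 1) * Gamma e /
        (Gamma (e + b - 1) * pochhammer (2 - e - b + d) (sum_list ps) * vpoch_vec hs ps) *
      hyp_P [(b - a) / 2, (a + b - 1) / 2, d, e + b - d - of_nat (sum_list ps) - 1] ([b] @ Delta2 (e + b - 1))
       (Y_poly hs ps d e (b - 1) 1 (-1))"
    (is "?L = _ * ?R")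
proof -
  define p where "p = sum_list ps"
  define s where "s = e + b - d - 1"
  obtain \<gamma> where \<gamma>: "newton_expansion d p (\<lambda>x. vpoch_vec (map (\<lambda>h. h + x) hs) ps) \<gamma>"
    using newton_expansion_vpoch_vec [OF len] p_def by blast
  define A where "A k = pochhammer a k * pochhammer (1 - a) k / (pochhammer b k * fact k)" for k
  \<comment> \<open>\<open>S j\<close> and \<open>T j\<close> are the two sides of the case l = 0,
    without prefactor, for d + j in place of d.\<close>
  define S where "S j = (\<Sum>k\<le>K. A k * (pochhammer (d + of_nat j) k / pochhammer e k))" for j
  define T where "T j = (\<Sum>t\<le>K. quad_coeff a b t * (pochhammer (d + of_nat j) t *
      pochhammer (s - of_nat j) t / pochhammer (e + b - 1) (2 * t)))" for j
  have s1: "2 - e - b + d = 1 - s"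
    by (simp add: s_def)

  have "vpoch_vec hs ps * ?L = (\<Sum>k\<le>K. A k * (pochhammer d k / pochhammer e k) *
      vpoch_vec (map (\<lambda>h. h + of_nat k) hs) ps)"
  proof -
    have "?L = (\<Sum>k\<le>K. pochhammer a k * pochhammer (1 - a) k * pochhammer d k *
        vpoch (map2 (\<lambda>h q. h + of_nat q) hs ps) k / (pochhammer b k * pochhammer e k * vpoch hs k * fact k))"
      unfolding hyp_def by (subst hyp_P_eq_sum [of K]) (use left in \<open>auto simp: vpoch_def mult_ac\<close>)
    moreover have cancel: "v * (x * y * z * w / (b' * e' * u * f)) = x * y / (b' * f) * (z / e') * v'"
      if "w * v = u * v'" "u \<noteq> 0" for v x y z w b' e' u f v' :: complex
    proof -
      have "v * (x * y * z * w / (b' * e' * u * f)) = x * y * z * (w * v) / (b' * e' * u * f)"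
        by simp
      then show ?thesis
        unfolding that(1) using that(2) by (simp add: mult_ac)
    qed
    ultimately show ?thesis
      unfolding A_def
      by (simp only: sum_distrib_left)
         (intro sum.cong refl cancel vpoch_shift_mult_vpoch_vec [OF len] vpoch_neq_0 [OF hs])
  qed
  also have "\<dots> = (\<Sum>k\<le>K. \<Sum>j\<le>p. \<gamma> j * (pochhammer d j * (A k * (pochhammer (d + of_nat j) k / pochhammer e k))))"
  proof (intro sum.cong refl)
    fix k
    have "vpoch_vec (map (\<lambda>h. h + of_nat k) hs) ps = (\<Sum>j\<le>p. \<gamma> j * pochhammer (d + of_nat k) j)"
      using \<gamma> by (simp add: newton_expansion_def add.commute [of d])
    then have "A k * (pochhammer d k / pochhammer e k) * vpoch_vec (map (\<lambda>h. h + of_nat k) hs) ps =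
      (\<Sum>j\<le>p. \<gamma> j * (A k / pochhammer e k * (pochhammer d k * pochhammer (d + of_nat k) j)))"
      by (simp add: sum_distrib_left mult_ac)
    also have "\<dots> = (\<Sum>j\<le>p. \<gamma> j * (pochhammer d j * (A k * (pochhammer (d + of_nat j) k / pochhammer e k))))"
      unfolding pochhammer_mult_swap [of d k] by (simp add: mult_ac)
    finally show "A k * (pochhammer d k / pochhammer e k) * vpoch_vec (map (\<lambda>h. h + of_nat k) hs) ps = \<dots>" .
  qed
  also have "\<dots> = (\<Sum>j\<le>p. \<gamma> j * (pochhammer d j * S j))"
    unfolding S_def by (subst sum.swap) (simp add: sum_distrib_left)
  finally have L: "vpoch_vec hs ps * ?L = \<dots>" .

  have nz': "pochhammer (1 - s) p \<noteq> 0"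
    using nz(1) by (simp add: s1 p_def)
  \<comment> \<open>The duplication formula; the power of 4 released from the denominator is the one
    contained in \<open>quad_coeff\<close>.\<close>
  have Delta: "pochhammer ((e + b - 1) / 2) t * pochhammer ((e + b - 1 + 1) / 2) t =
     pochhammer (e + b - 1) (2 * t) / 4 ^ t" for t
    using pochhammer_double [of "(e + b - 1) / 2" t]
    by (simp add: add_divide_distrib diff_divide_distrib power_mult)
  have "?R = (\<Sum>t\<le>K. quad_coeff a b t * pochhammer d t * pochhammer (s - of_nat p) t /
      pochhammer (e + b - 1) (2 * t) * Y_poly hs ps d e (b - 1) 1 (-1) (of_nat t))"
  proof (subst hyp_P_eq_sum [of K])
    fix t assume "t > K"
    from right [OF this] show "vpoch [(b - a) / 2, (a + b - 1) / 2, d, e + b - d - of_nat (sum_list ps) - 1] t = 0"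
      using b by (auto simp: quad_coeff_def vpoch_def pochhammer_neq_0)
  next
    have "vpoch [(b - a) / 2, (a + b - 1) / 2, d, e + b - d - of_nat (sum_list ps) - 1] t /
        (vpoch ([b] @ Delta2 (e + b - 1)) t * fact t) =
      quad_coeff a b t * pochhammer d t * pochhammer (s - of_nat p) t / pochhammer (e + b - 1) (2 * t)" for t
    proof -
      have "vpoch ([b] @ Delta2 (e + b - 1)) t = pochhammer b t * (pochhammer (e + b - 1) (2 * t) / 4 ^ t)"
        unfolding Delta [symmetric] by (simp add: vpoch_def Delta2_def)
      moreover have "vpoch [(b - a) / 2, (a + b - 1) / 2, d, e + b - d - of_nat (sum_list ps) - 1] t =
        pochhammer ((b - a) / 2) t * pochhammer ((a + b - 1) / 2) t * pochhammer d t * pochhammer (s - of_nat p) t"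
        by (simp add: vpoch_def s_def p_def algebra_simps)
      ultimately show ?thesis
        by (simp add: quad_coeff_def mult_ac)
    qed
    then show "(\<Sum>n\<le>K. vpoch [(b - a) / 2, (a + b - 1) / 2, d, e + b - d - of_nat (sum_list ps) - 1] n /
        (vpoch ([b] @ Delta2 (e + b - 1)) n * fact n) * Y_poly hs ps d e (b - 1) 1 (-1) (of_nat n)) =
      (\<Sum>t\<le>K. quad_coeff a b t * pochhammer d t * pochhammer (s - of_nat p) t /
      pochhammer (e + b - 1) (2 * t) * Y_poly hs ps d e (b - 1) 1 (-1) (of_nat t))"
      by simp
  qed
  then have "?R / pochhammer (1 - s) p = (\<Sum>t\<le>K. quad_coeff a b t * pochhammer d t * pochhammer (s - of_nat p) t /
      pochhammer (e + b - 1) (2 * t) * Y_poly hs ps d e (b - 1) 1 (-1) (of_nat t)) / pochhammer (1 - s) p"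
    by (simp only:)
  also have "\<dots> = (\<Sum>t\<le>K. \<Sum>j\<le>p. \<gamma> j * (pochhammer (d - e + 1) j / pochhammer (1 - s) j *
     (pochhammer d j * (quad_coeff a b t * (pochhammer (d + of_nat j) t *
      pochhammer (s - of_nat j) t / pochhammer (e + b - 1) (2 * t)))))) / Gamma (e - d)"
    unfolding sum_divide_distrib
  proof (intro sum.cong refl)
    fix t
    define q where "q = quad_coeff a b t / (pochhammer (e + b - 1) (2 * t) * Gamma (e - d))"
    \<comment> \<open>For u = 1, v = -1 and \<lambda> = b - 1 the last Pochhammer argument is 1 - s
      - t + j, the form that \<open>pochhammer_ratio\<close> expects.\<close>
    have "Y_poly hs ps d e (b - 1) 1 (-1) (of_nat t) = (\<Sum>j\<le>p. \<gamma> j * (pochhammer (d - e + 1) j *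
      pochhammer (d + of_nat t) j * pochhammer (1 - s - of_nat t + of_nat j) (p - j))) / Gamma (e - d)"
      unfolding Y_poly_newton [OF len Y \<gamma> [unfolded p_def]] p_def s_def by (simp add: algebra_simps)
    then have "quad_coeff a b t * pochhammer d t * pochhammer (s - of_nat p) t /
        pochhammer (e + b - 1) (2 * t) * Y_poly hs ps d e (b - 1) 1 (-1) (of_nat t) / pochhammer (1 - s) p =
      (\<Sum>j\<le>p. q * \<gamma> j * pochhammer (d - e + 1) j * (pochhammer d t * pochhammer (d + of_nat t) j) *
        (pochhammer (s - of_nat p) t * pochhammer (1 - s - of_nat t + of_nat j) (p - j) / pochhammer (1 - s) p))"
      by (simp add: q_def sum_distrib_left sum_divide_distrib mult_ac)
    also have "\<dots> = (\<Sum>j\<le>p. q * \<gamma> j * pochhammer (d - e + 1) j * (pochhammer d j * pochhammer (d + of_nat j) t) *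
        (pochhammer (s - of_nat j) t / pochhammer (1 - s) j))"
      using nz' by (intro sum.cong refl) (simp add: pochhammer_ratio pochhammer_mult_swap [of d t])
    finally show "quad_coeff a b t * pochhammer d t * pochhammer (s - of_nat p) t /
        pochhammer (e + b - 1) (2 * t) * Y_poly hs ps d e (b - 1) 1 (-1) (of_nat t) / pochhammer (1 - s) p =
      (\<Sum>j\<le>p. \<gamma> j * (pochhammer (d - e + 1) j / pochhammer (1 - s) j *
     (pochhammer d j * (quad_coeff a b t * (pochhammer (d + of_nat j) t *
      pochhammer (s - of_nat j) t / pochhammer (e + b - 1) (2 * t))))) / Gamma (e - d))"
      by (simp add: q_def mult_ac)
  qed
  also have "\<dots> = (\<Sum>j\<le>p. \<gamma> j * (pochhammer (d - e + 1) j / pochhammer (1 - s) j * (pochhammer d j * T j))) / Gamma (e - d)"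
    unfolding T_def by (subst sum.swap) (simp add: sum_distrib_left)
  finally have R: "?R / pochhammer (1 - s) p = \<dots>" .

  have "vpoch_vec hs ps * ?L = (\<Sum>j\<le>p. \<gamma> j * (Gamma s * Gamma e / (Gamma (e + b - 1) * Gamma (e - d)) *
      (pochhammer (d - e + 1) j / pochhammer (1 - s) j) * (pochhammer d j * T j)))"
    unfolding L
  proof (intro sum.cong refl)
    fix j assume "j \<in> {..p}"
    then have "shifted_identity a b d e K j"
      by (simp add: shifted p_def)
    then show "\<gamma> j * (pochhammer d j * S j) = \<gamma> j * (Gamma s * Gamma e / (Gamma (e + b - 1) * Gamma (e - d)) *
      (pochhammer (d - e + 1) j / pochhammer (1 - s) j) * (pochhammer d j * T j))"
      unfolding shifted_identity_def S_def T_def A_def s1 s_def [symmetric] by simp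
  qed
  also have "\<dots> = Gamma s * Gamma e / Gamma (e + b - 1) * (?R / pochhammer (1 - s) p)"
    unfolding R by (simp add: sum_distrib_left sum_divide_distrib mult_ac)
  finally have "vpoch_vec hs ps * ?L = \<dots>" .
  then have "?L = Gamma s * Gamma e / Gamma (e + b - 1) * (?R / pochhammer (1 - s) p) / vpoch_vec hs ps"
    using nz(2) by (metis nonzero_mult_div_cancel_left)
  then show ?thesis
    unfolding s1 p_def [symmetric] s_def [symmetric] by (simp add: mult_ac)
qed

section \<open>Termination of both series\<close>

text \<open>Replacing a by 1 - a swaps the two upper parameters; so the one of a and 1 - a that
  terminates may be taken as a.\<close>

lemma quad_coeff_reflect: "quad_coeff (1 - a) b t = quad_coeff a b t"
proof -
  have "(b - (1 - a)) / 2 = (a + b - 1) / 2" "(1 - a + b - 1) / 2 = (b - a) / 2"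
    by simp_all
  then show ?thesis
    unfolding quad_coeff_def by (simp only: mult_ac)
qed

lemma shifted_identity_reflect: "shifted_identity (1 - a) b d e K j = shifted_identity a b d e K j"
  by (simp add: shifted_identity_def quad_coeff_reflect mult.commute [of "pochhammer (1 - a) _"])

text \<open>(b-a)/2 = -m would give b = -(n+2m), which is excluded. So (a+b-1)/2 = -m and b = n + 1
  - 2m, where 2m > n is excluded likewise. Hence b = B + 1 with B + 2m = n, exactly the bound
  \<open>shifted_identity_lower_nat\<close> asks for.\<close>

lemma shifted_identity_terminating:
  assumes b: "b \<notin> \<int>\<^sub>\<le>\<^sub>0" and e: "e \<notin> \<int>\<^sub>\<le>\<^sub>0" and ed: "e - d \<notin> \<int>\<^sub>\<le>\<^sub>0"
    and a: "a = - of_nat n" and m: "(b - a) / 2 \<in> \<int>\<^sub>\<le>\<^sub>0 \<or> (a + b - 1) / 2 \<in> \<int>\<^sub>\<le>\<^sub>0"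
  shows "(\<forall>t>n. quad_coeff a b t = 0) \<and>
    (\<forall>j. pochhammer (2 - e - b + d) j \<noteq> 0 \<longrightarrow> shifted_identity a b d e n j)"
proof -
  have "(b - a) / 2 \<notin> \<int>\<^sub>\<le>\<^sub>0"
  proof
    assume "(b - a) / 2 \<in> \<int>\<^sub>\<le>\<^sub>0"
    then obtain m where "(b - a) / 2 = - of_nat m"
      by (auto elim: nonpos_Ints_cases')
    then have "b - a = - of_nat (2 * m)"
      by simp
    then have "b = - of_nat (2 * m) + a"
      by (metis diff_add_cancel)
    then have "b = - of_nat (n + 2 * m)"
      by (simp add: a)
    then show False
      using b by (metis minus_of_nat_in_nonpos_Ints)
  qed
  with m have "(a + b - 1) / 2 \<in> \<int>\<^sub>\<le>\<^sub>0"
    by blast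
  then obtain m where m: "(a + b - 1) / 2 = - of_nat m"
    by (auto elim: nonpos_Ints_cases')
  then have "a + b - 1 = - of_nat (2 * m)"
    by simp
  then have bnm: "b + of_nat (2 * m) = of_nat (n + 1)"
    by (simp add: a algebra_simps)
  have "2 * m \<le> n"
  proof (rule ccontr)
    assume "\<not> 2 * m \<le> n"
    then obtain r where r: "2 * m = n + 1 + r"
      using le_Suc_ex [of "n + 1" "2 * m"] by auto
    from bnm have "b = - of_nat r"
      unfolding r by (simp add: algebra_simps add_eq_0_iff2)
    then show False
      using b by simp
  qed
  then obtain B where B: "n = B + 2 * m"
    using le_Suc_ex add.commute by metis
  have bB: "b = of_nat B + 1"
    using bnm unfolding B by simp
  have q: "quad_coeff a b t = 0" if "t > m" for t
    using that by (simp add: quad_coeff_def m pochhammer_of_nat_eq_0_iff)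
  show ?thesis
    using q shifted_identity_lower_nat [OF e ed _ _ bB, of m n a] B by auto
qed

theorem mainTheorem12:
  fixes l :: nat and ps :: "nat list" and p :: nat
    and hs :: "complex list" and a b d e :: complex
    and upL lowL upR lowR :: "complex list"
  assumes "length ps = l" and "length hs = l" and "p = sum_list ps"
    and upL: "upL = [a, 1 - a, d] @ map2 (\<lambda>h q. h + of_nat q) hs ps"
    and lowL: "lowL = [b, e] @ hs"
    and upR: "upR = [(b - a) / 2, (a + b - 1) / 2, d, e + b - d - of_nat p - 1]"
    and lowR: "lowR = [b] @ Delta2 (e + b - 1)"
    and "terminating upL" and "terminating upR"
    and "admissible_lower lowL" and "admissible_lower lowR"
    and "admissible_lower (Y_lower hs ps d)"
    and "e + b - d - 1 \<notin> \<int>\<^sub>\<le>\<^sub>0" and "e \<notin> \<int>\<^sub>\<le>\<^sub>0"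
    and "e + b - 1 \<notin> \<int>\<^sub>\<le>\<^sub>0" and "e - d \<notin> \<int>\<^sub>\<le>\<^sub>0"
    and "pochhammer (2 - e - b + d) p \<noteq> 0" and "vpoch_vec hs ps \<noteq> 0"
  shows "hyp upL lowL =
      Gamma (e + b - d - 1) * Gamma e /
        (Gamma (e + b - 1) * pochhammer (2 - e - b + d) p * vpoch_vec hs ps) *
      hyp_P upR lowR (Y_poly hs ps d e (b - 1) 1 (-1))"
proof -
  have len: "length hs = length ps"
    using assms(1,2) by simp
  have b: "b \<notin> \<int>\<^sub>\<le>\<^sub>0" and hs: "admissible_lower hs"
    using \<open>admissible_lower lowL\<close> by (auto simp: lowL admissible_lower_def)
  have nz: "pochhammer (2 - e - b + d) j \<noteq> 0" if "j \<le> p" for j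
    using pochhammer_neq_0_mono [OF \<open>pochhammer (2 - e - b + d) p \<noteq> 0\<close> that] .

  \<comment> \<open>Since no h_i is a non-positive integer, no h_i + p_i is one either; the left
    series must terminate through a, 1 - a or d.\<close>
  have "h + of_nat q \<notin> \<int>\<^sub>\<le>\<^sub>0" if "(h, q) \<in> set (zip hs ps)" for h q
    using hs set_zip_leftD [OF that] by (auto simp: admissible_lower_def intro!: plus_nat_notin_nonpos_Ints)
  then have L: "a \<in> \<int>\<^sub>\<le>\<^sub>0 \<or> 1 - a \<in> \<int>\<^sub>\<le>\<^sub>0 \<or> d \<in> \<int>\<^sub>\<le>\<^sub>0"
    using \<open>terminating upL\<close> by (fastforce simp: terminating_def upL)
  \<comment> \<open>If \<open>e + b - d - p - 1 = - n\<close> then, as \<open>e + b - d - 1\<close> is not a non-positive integer,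
    \<open>n < p\<close> and \<open>(2 - e - b + d)\<^sub>p\<close> has a zero factor.\<close>
  have "e + b - d - of_nat p - 1 \<notin> \<int>\<^sub>\<le>\<^sub>0"
  proof
    assume "e + b - d - of_nat p - 1 \<in> \<int>\<^sub>\<le>\<^sub>0"
    then obtain n where n: "e + b - d - of_nat p - 1 = - of_nat n"
      by (auto elim: nonpos_Ints_cases')
    show False
    proof (cases "n < p")
      case True
      then obtain k where p: "p = n + Suc k"
        using less_imp_Suc_add by force
      have "2 - e - b + d = - of_nat k"
        using n by (simp add: p algebra_simps)
      moreover have "k < p"
        by (simp add: p)
      ultimately show False
        using \<open>pochhammer (2 - e - b + d) p \<noteq> 0\<close> by (simp add: pochhammer_of_nat_eq_0_iff)
    next
      case False
      then obtain k where k: "n = p + k"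
        using le_Suc_ex not_less by blast
      have "e + b - d - 1 = - of_nat k"
        using n by (simp add: k algebra_simps)
      then show False
        using \<open>e + b - d - 1 \<notin> \<int>\<^sub>\<le>\<^sub>0\<close> by simp
    qed
  qed
  then have R: "(b - a) / 2 \<in> \<int>\<^sub>\<le>\<^sub>0 \<or> (a + b - 1) / 2 \<in> \<int>\<^sub>\<le>\<^sub>0 \<or> d \<in> \<int>\<^sub>\<le>\<^sub>0"
    using \<open>terminating upR\<close> by (auto simp: terminating_def upR)

  \<comment> \<open>One bound K has to truncate both series and serve all j \<le> p. The witness is
    n with d = -n, or else n with -n the terminating one of a and 1 - a.\<close>
  have "\<exists>K. (\<forall>k>K. pochhammer a k * pochhammer (1 - a) k * pochhammer d k = 0) \<and>
    (\<forall>t>K. quad_coeff a b t * pochhammer d t = 0) \<and> (\<forall>j\<le>p. shifted_identity a b d e K j)"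
  proof (cases "d \<in> \<int>\<^sub>\<le>\<^sub>0")
    case True
    then obtain n where d: "d = - of_nat n"
      by (auto elim: nonpos_Ints_cases')
    have "\<forall>k>n. pochhammer d k = 0"
      by (simp add: d pochhammer_of_nat_eq_0_iff)
    then show ?thesis
      using shifted_identity_upper_nat [OF b \<open>e \<notin> _\<close> \<open>e + b - 1 \<notin> _\<close> d]
      by (intro exI [of _ n]) simp
  next
    case d: False
    define a' where "a' = (if a \<in> \<int>\<^sub>\<le>\<^sub>0 then a else 1 - a)"
    have a': "a' = a \<or> a' = 1 - a"
      by (simp add: a'_def)
    have "a' \<in> \<int>\<^sub>\<le>\<^sub>0"
      using L d by (auto simp: a'_def)
    then obtain n where n: "a' = - of_nat n"
      by (auto elim: nonpos_Ints_cases')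
    have "(b - (1 - a)) / 2 = (a + b - 1) / 2" "(1 - a + b - 1) / 2 = (b - a) / 2"
      by simp_all
    then have "(b - a') / 2 \<in> \<int>\<^sub>\<le>\<^sub>0 \<or> (a' + b - 1) / 2 \<in> \<int>\<^sub>\<le>\<^sub>0"
      using R d a' by metis
    note * = shifted_identity_terminating [OF b \<open>e \<notin> _\<close> \<open>e - d \<notin> _\<close> n this]
    have **: "quad_coeff a' b t = quad_coeff a b t" "shifted_identity a' b d e K j = shifted_identity a b d e K j"
      for t K j
      using a' by (auto simp: quad_coeff_reflect shifted_identity_reflect)
    have "pochhammer a k * pochhammer (1 - a) k = pochhammer a' k * pochhammer (1 - a') k" for k
      using a' by (auto simp: mult.commute)
    moreover have "pochhammer a' k = 0" if "k > n" for k
      using that by (simp add: n pochhammer_of_nat_eq_0_iff)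
    ultimately show ?thesis
      using * nz unfolding ** by (intro exI [of _ n]) auto
  qed
  then obtain K where "\<And>k. k > K \<Longrightarrow> pochhammer a k * pochhammer (1 - a) k * pochhammer d k = 0"
      "\<And>t. t > K \<Longrightarrow> quad_coeff a b t * pochhammer d t = 0"
      "\<And>j. j \<le> sum_list ps \<Longrightarrow> shifted_identity a b d e K j"
    unfolding \<open>p = _\<close> by blast
  then show ?thesis
    unfolding upL lowL upR lowR \<open>p = _\<close>
    using len b \<open>e \<notin> _\<close> hs assms(12) nz [OF order_refl, unfolded \<open>p = _\<close>] \<open>vpoch_vec hs ps \<noteq> 0\<close>
    by (intro hypergeometric_identity_of_shifted [where K = K])
qed

end
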